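(* Let $H$ and $H'$ be finite groups and let $\varphi\colon H\to H'$ be an isomorphism. Let $\underline{R}$ be an $H'$-Tambara functor. Then the assignment \[ (\varphi^*\underline{R})(H/K):=\underline{R}(\varphi H/\varphi K)\qquad(K\leq H) \] gives rise to an $H$-Tambara functor $\varphi^*\underline{R}$.
   Context: The structure maps of $\varphi^*\underline{R}$ are those of $\underline{R}$ transported along $\varphi$: for $h\in H$ and subgroups $K<L\leq H$, conjugation is $c_h(\varphi^*\underline{R})=c_{\varphi(h)}(\underline{R})$, restriction is $\mathrm{res}_K^L(\varphi^*\underline{R})=\mathrm{res}_{\varphi K}^{\varphi L}(\underline{R})$, transfer is $\mathrm{tr}_K^L(\varphi^*\underline{R})=\mathrm{tr}_{\varphi K}^{\varphi L}(\underline{R})$, and norm is $\mathrm{norm}_K^L(\varphi^*\underline{R})=\mathrm{norm}_{\varphi K}^{\varphi L}(\underline{R})$. *)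

theory Defs
  imports
    "HOL-Algebra.Ring"
    "HOL-Algebra.Left_Coset"
    "HOL-Algebra.Group_Action"
begin

section \<open>Finite G-sets\<close>

record ('g, 'x) gset =
  pts :: "'x set"
  act :: "'g \<Rightarrow> 'x \<Rightarrow> 'x"

text \<open>
  A Tambara functor is defined on the category of finite G-sets. To have a type of objects,
  we use the finite G-sets whose points lie in the infinite set of pairs of a natural number and a
  subset of G. Every finite G-set is isomorphic to one of these, so they form
  a full subcategory equivalent to all finite G-sets; in particular it has finite coproducts,
  pullbacks and exponential diagrams, all of which are given below up to isomorphism.
  The subsets of G are there so that the orbits G/K, with their cosets as points, are
  literally objects (with first component 0).

  The actions are extensional, as are the equivariant maps, so that equal objects and morphisms
  are equal as terms.
\<close>

type_synonym 'g point = "nat \<times> 'g set"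

definition fin_gsets :: "('g, 'm) monoid_scheme \<Rightarrow> ('g, 'g point) gset set" where
  "fin_gsets G =
     {X. finite (pts X) \<and> pts X \<subseteq> UNIV \<times> Pow (carrier G) \<and>
         group_action G (pts X) (act X) \<and> act X \<in> extensional (carrier G)}"

definition gmaps ::
  "('g, 'm) monoid_scheme \<Rightarrow> ('g, 'x) gset \<Rightarrow> ('g, 'y) gset \<Rightarrow> ('x \<Rightarrow> 'y) set" where
  "gmaps G X Y =
     {f \<in> pts X \<rightarrow>\<^sub>E pts Y. \<forall>g\<in>carrier G. \<forall>x\<in>pts X. f (act X g x) = act Y g (f x)}"

definition gisos ::
  "('g, 'm) monoid_scheme \<Rightarrow> ('g, 'x) gset \<Rightarrow> ('g, 'y) gset \<Rightarrow> ('x \<Rightarrow> 'y) set" where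
  "gisos G X Y = {f \<in> gmaps G X Y. bij_betw f (pts X) (pts Y)}"

text \<open>\<open>i\<close> and \<open>j\<close> exhibit \<open>Z\<close> as the disjoint union of \<open>X\<close> and \<open>Y\<close>.\<close>

definition is_coproduct ::
  "('g, 'm) monoid_scheme \<Rightarrow> ('g, 'x) gset \<Rightarrow> ('g, 'y) gset \<Rightarrow> ('g, 'z) gset
    \<Rightarrow> ('x \<Rightarrow> 'z) \<Rightarrow> ('y \<Rightarrow> 'z) \<Rightarrow> bool" where
  "is_coproduct G X Y Z i j \<longleftrightarrow>
     i \<in> gmaps G X Z \<and> j \<in> gmaps G Y Z \<and> inj_on i (pts X) \<and> inj_on j (pts Y) \<and>
     i ` pts X \<inter> j ` pts Y = {} \<and> i ` pts X \<union> j ` pts Y = pts Z"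

text \<open>The fibre product of \<open>f : X \<rightarrow> Y\<close> and \<open>h : Z \<rightarrow> Y\<close>.\<close>

definition fibre_product ::
  "('g, 'm) monoid_scheme \<Rightarrow> ('g, 'x) gset \<Rightarrow> ('x \<Rightarrow> 'y) \<Rightarrow> ('g, 'z) gset \<Rightarrow> ('z \<Rightarrow> 'y)
    \<Rightarrow> ('g, 'x \<times> 'z) gset" where
  "fibre_product G X f Z h =
     (let P = {(x, z). x \<in> pts X \<and> z \<in> pts Z \<and> f x = h z}
      in \<lparr>pts = P, act = (\<lambda>g\<in>carrier G. \<lambda>(x, z)\<in>P. (act X g x, act Z g z))\<rparr>)"

text \<open>
  The square with \<open>a : W \<rightarrow> X\<close>, \<open>b : W \<rightarrow> Z\<close>, \<open>f : X \<rightarrow> Y\<close>, \<open>h : Z \<rightarrow> Y\<close> is a pullback square.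
  Membership in \<open>gisos\<close> includes commutativity.
\<close>

definition is_pullback ::
  "('g, 'm) monoid_scheme \<Rightarrow> ('g, 'w) gset \<Rightarrow> ('g, 'x) gset \<Rightarrow> ('g, 'z) gset \<Rightarrow> ('g, 'y) gset
    \<Rightarrow> ('w \<Rightarrow> 'x) \<Rightarrow> ('w \<Rightarrow> 'z) \<Rightarrow> ('x \<Rightarrow> 'y) \<Rightarrow> ('z \<Rightarrow> 'y) \<Rightarrow> bool" where
  "is_pullback G W X Z Y a b f h \<longleftrightarrow>
     a \<in> gmaps G W X \<and> b \<in> gmaps G W Z \<and> f \<in> gmaps G X Y \<and> h \<in> gmaps G Z Y \<and>
     (\<lambda>w\<in>pts W. (a w, b w)) \<in> gisos G W (fibre_product G X f Z h)"

text \<open>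
  The dependent product of \<open>q : A \<rightarrow> X\<close> along \<open>f : X \<rightarrow> Y\<close>: its points are the pairs \<open>(y, s)\<close> with
  \<open>s\<close> a (not necessarily equivariant) section of \<open>q\<close> over the fibre of \<open>f\<close> at \<open>y\<close>.
  An element \<open>g\<close> sends \<open>(y, s)\<close> to \<open>(g y, g s g\<^sup>-\<^sup>1)\<close>.
\<close>

definition dependent_product ::
  "('g, 'm) monoid_scheme \<Rightarrow> ('g, 'a) gset \<Rightarrow> ('a \<Rightarrow> 'x) \<Rightarrow> ('g, 'x) gset \<Rightarrow> ('x \<Rightarrow> 'y)
    \<Rightarrow> ('g, 'y) gset \<Rightarrow> ('g, 'y \<times> ('x \<Rightarrow> 'a)) gset" where
  "dependent_product G A q X f Y =
     (let F = (\<lambda>y. {x \<in> pts X. f x = y});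
          P = {(y, s). y \<in> pts Y \<and> s \<in> F y \<rightarrow>\<^sub>E pts A \<and> (\<forall>x\<in>F y. q (s x) = x)}
      in \<lparr>pts = P,
          act = (\<lambda>g\<in>carrier G. \<lambda>(y, s)\<in>P.
                  (act Y g y, \<lambda>x\<in>F (act Y g y). act A g (s (act X (inv\<^bsub>G\<^esub> g) x))))\<rparr>)"

text \<open>
  A diagram isomorphic to the canonical exponential diagram of \<open>q : A \<rightarrow> X\<close> and \<open>f : X \<rightarrow> Y\<close>:
  \<open>q' : Y' \<rightarrow> Y\<close> is the dependent product, \<open>f' : X' \<rightarrow> Y'\<close> is the pullback of \<open>f\<close> along \<open>q'\<close>,
  and \<open>e : X' \<rightarrow> A\<close> is the evaluation \<open>(x, (y, s)) \<mapsto> s x\<close>.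
\<close>

definition is_exponential ::
  "('g, 'm) monoid_scheme \<Rightarrow> ('g, 'a) gset \<Rightarrow> ('g, 'x) gset \<Rightarrow> ('g, 'y) gset
    \<Rightarrow> ('g, 'u) gset \<Rightarrow> ('g, 'v) gset
    \<Rightarrow> ('a \<Rightarrow> 'x) \<Rightarrow> ('x \<Rightarrow> 'y) \<Rightarrow> ('u \<Rightarrow> 'a) \<Rightarrow> ('u \<Rightarrow> 'v) \<Rightarrow> ('v \<Rightarrow> 'y) \<Rightarrow> bool" where
  "is_exponential G A X Y X' Y' q f e f' q' \<longleftrightarrow>
     q \<in> gmaps G A X \<and> f \<in> gmaps G X Y \<and>
     e \<in> gmaps G X' A \<and> f' \<in> gmaps G X' Y' \<and> q' \<in> gmaps G Y' Y \<and>
     (\<exists>\<beta> \<in> gisos G Y' (dependent_product G A q X f Y).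
      \<exists>\<alpha> \<in> gisos G X' (fibre_product G X f (dependent_product G A q X f Y) fst).
        (\<forall>v\<in>pts Y'. fst (\<beta> v) = q' v) \<and>
        (\<forall>u\<in>pts X'. snd (\<alpha> u) = \<beta> (f' u) \<and> e u = (snd (snd (\<alpha> u))) (fst (\<alpha> u))))"


section \<open>Tambara functors\<close>

text \<open>
  For \<open>f : X \<rightarrow> Y\<close>, the maps are \<open>rst R X Y f : R(Y) \<rightarrow> R(X)\<close> (the contravariant part),
  \<open>trf R X Y f : R(X) \<rightarrow> R(Y)\<close> (additive) and \<open>nrm R X Y f : R(X) \<rightarrow> R(Y)\<close> (multiplicative).
\<close>

record ('g, 'r) tambara_data =
  level :: "('g, 'g point) gset \<Rightarrow> 'r ring"
  rst :: "('g, 'g point) gset \<Rightarrow> ('g, 'g point) gset \<Rightarrow> ('g point \<Rightarrow> 'g point) \<Rightarrow> 'r \<Rightarrow> 'r"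
  trf :: "('g, 'g point) gset \<Rightarrow> ('g, 'g point) gset \<Rightarrow> ('g point \<Rightarrow> 'g point) \<Rightarrow> 'r \<Rightarrow> 'r"
  nrm :: "('g, 'g point) gset \<Rightarrow> ('g, 'g point) gset \<Rightarrow> ('g point \<Rightarrow> 'g point) \<Rightarrow> 'r \<Rightarrow> 'r"

text \<open>
  The ring structures are part of the data, but the axioms force addition and multiplication
  to be the transfer and the norm along the fold maps \<open>X \<squnion> X \<rightarrow> X\<close>, and 0 and 1 to be the
  transfer and the norm along \<open>\<emptyset> \<rightarrow> X\<close>. The levels are rings, not just semirings.
\<close>

locale tambara_functor = group G for G (structure) +
  fixes R :: "('a, 'r) tambara_data"
  assumes finite_group: "finite (carrier G)"
    and level_cring: "X \<in> fin_gsets G \<Longrightarrow> cring (level R X)"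
    and rst_hom: "\<lbrakk>X \<in> fin_gsets G; Y \<in> fin_gsets G; f \<in> gmaps G X Y\<rbrakk>
      \<Longrightarrow> rst R X Y f \<in> ring_hom (level R Y) (level R X)"
    and trf_hom: "\<lbrakk>X \<in> fin_gsets G; Y \<in> fin_gsets G; f \<in> gmaps G X Y\<rbrakk>
      \<Longrightarrow> trf R X Y f \<in> hom (add_monoid (level R X)) (add_monoid (level R Y))"
    and nrm_hom: "\<lbrakk>X \<in> fin_gsets G; Y \<in> fin_gsets G; f \<in> gmaps G X Y\<rbrakk>
      \<Longrightarrow> nrm R X Y f \<in> hom (level R X) (level R Y)"
    and nrm_one: "\<lbrakk>X \<in> fin_gsets G; Y \<in> fin_gsets G; f \<in> gmaps G X Y\<rbrakk>
      \<Longrightarrow> nrm R X Y f \<one>\<^bsub>level R X\<^esub> = \<one>\<^bsub>level R Y\<^esub>"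
    and rst_id: "\<lbrakk>X \<in> fin_gsets G; a \<in> carrier (level R X)\<rbrakk>
      \<Longrightarrow> rst R X X (\<lambda>x\<in>pts X. x) a = a"
    and trf_id: "\<lbrakk>X \<in> fin_gsets G; a \<in> carrier (level R X)\<rbrakk>
      \<Longrightarrow> trf R X X (\<lambda>x\<in>pts X. x) a = a"
    and nrm_id: "\<lbrakk>X \<in> fin_gsets G; a \<in> carrier (level R X)\<rbrakk>
      \<Longrightarrow> nrm R X X (\<lambda>x\<in>pts X. x) a = a"
    and rst_comp: "\<lbrakk>X \<in> fin_gsets G; Y \<in> fin_gsets G; Z \<in> fin_gsets G;
        f \<in> gmaps G X Y; h \<in> gmaps G Y Z; a \<in> carrier (level R Z)\<rbrakk>
      \<Longrightarrow> rst R X Z (compose (pts X) h f) a = rst R X Y f (rst R Y Z h a)"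
    and trf_comp: "\<lbrakk>X \<in> fin_gsets G; Y \<in> fin_gsets G; Z \<in> fin_gsets G;
        f \<in> gmaps G X Y; h \<in> gmaps G Y Z; a \<in> carrier (level R X)\<rbrakk>
      \<Longrightarrow> trf R X Z (compose (pts X) h f) a = trf R Y Z h (trf R X Y f a)"
    and nrm_comp: "\<lbrakk>X \<in> fin_gsets G; Y \<in> fin_gsets G; Z \<in> fin_gsets G;
        f \<in> gmaps G X Y; h \<in> gmaps G Y Z; a \<in> carrier (level R X)\<rbrakk>
      \<Longrightarrow> nrm R X Z (compose (pts X) h f) a = nrm R Y Z h (nrm R X Y f a)"
    and level_empty: "\<lbrakk>X \<in> fin_gsets G; pts X = {}\<rbrakk>
      \<Longrightarrow> carrier (level R X) = {\<zero>\<^bsub>level R X\<^esub>}"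
    and level_coproduct: "\<lbrakk>X \<in> fin_gsets G; Y \<in> fin_gsets G; Z \<in> fin_gsets G;
        is_coproduct G X Y Z i j\<rbrakk>
      \<Longrightarrow> bij_betw (\<lambda>c. (rst R X Z i c, rst R Y Z j c))
            (carrier (level R Z)) (carrier (level R X) \<times> carrier (level R Y))"
    and rst_trf: "\<lbrakk>W \<in> fin_gsets G; X \<in> fin_gsets G; Z \<in> fin_gsets G; Y \<in> fin_gsets G;
        is_pullback G W X Z Y p p' f h; a \<in> carrier (level R X)\<rbrakk>
      \<Longrightarrow> rst R Z Y h (trf R X Y f a) = trf R W Z p' (rst R W X p a)"
    and rst_nrm: "\<lbrakk>W \<in> fin_gsets G; X \<in> fin_gsets G; Z \<in> fin_gsets G; Y \<in> fin_gsets G;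
        is_pullback G W X Z Y p p' f h; a \<in> carrier (level R X)\<rbrakk>
      \<Longrightarrow> rst R Z Y h (nrm R X Y f a) = nrm R W Z p' (rst R W X p a)"
    and nrm_trf: "\<lbrakk>A \<in> fin_gsets G; X \<in> fin_gsets G; Y \<in> fin_gsets G;
        X' \<in> fin_gsets G; Y' \<in> fin_gsets G;
        is_exponential G A X Y X' Y' q f e f' q'; a \<in> carrier (level R A)\<rbrakk>
      \<Longrightarrow> nrm R X Y f (trf R A X q a) = trf R Y' Y q' (nrm R X' Y' f' (rst R X' A e a))"


section \<open>Values and structure maps on orbits\<close>

definition quot :: "('g, 'm) monoid_scheme \<Rightarrow> 'g set \<Rightarrow> ('g, 'g point) gset" where
  "quot G K =
     (let P = {0} \<times> (lcosets\<^bsub>G\<^esub> K)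
      in \<lparr>pts = P, act = (\<lambda>g\<in>carrier G. \<lambda>(n, C)\<in>P. (n, g <#\<^bsub>G\<^esub> C))\<rparr>)"

text \<open>The projection \<open>G/K \<rightarrow> G/L\<close>, \<open>gK \<mapsto> gL\<close>, for \<open>K \<subseteq> L\<close>.\<close>

definition proj :: "('g, 'm) monoid_scheme \<Rightarrow> 'g set \<Rightarrow> 'g set \<Rightarrow> 'g point \<Rightarrow> 'g point" where
  "proj G K L = (\<lambda>(n, C)\<in>pts (quot G K). (n, C <#>\<^bsub>G\<^esub> L))"

definition conj_subgroup :: "('g, 'm) monoid_scheme \<Rightarrow> 'g \<Rightarrow> 'g set \<Rightarrow> 'g set" where
  "conj_subgroup G g K = g <#\<^bsub>G\<^esub> K #>\<^bsub>G\<^esub> inv\<^bsub>G\<^esub> g"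

text \<open>The isomorphism \<open>G/gKg\<^sup>-\<^sup>1 \<rightarrow> G/K\<close>, \<open>x(gKg\<^sup>-\<^sup>1) \<mapsto> xgK\<close>; here \<open>xgK = x(gKg\<^sup>-\<^sup>1)g\<close>.\<close>

definition conj_map :: "('g, 'm) monoid_scheme \<Rightarrow> 'g \<Rightarrow> 'g set \<Rightarrow> 'g point \<Rightarrow> 'g point" where
  "conj_map G g K = (\<lambda>(n, C)\<in>pts (quot G (conj_subgroup G g K)). (n, C #>\<^bsub>G\<^esub> g))"

definition tconj ::
  "('g, 'm) monoid_scheme \<Rightarrow> ('g, 'r) tambara_data \<Rightarrow> 'g \<Rightarrow> 'g set \<Rightarrow> 'r \<Rightarrow> 'r" where
  "tconj G R g K = rst R (quot G (conj_subgroup G g K)) (quot G K) (conj_map G g K)"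

definition tres ::
  "('g, 'm) monoid_scheme \<Rightarrow> ('g, 'r) tambara_data \<Rightarrow> 'g set \<Rightarrow> 'g set \<Rightarrow> 'r \<Rightarrow> 'r" where
  "tres G R K L = rst R (quot G K) (quot G L) (proj G K L)"

definition ttr ::
  "('g, 'm) monoid_scheme \<Rightarrow> ('g, 'r) tambara_data \<Rightarrow> 'g set \<Rightarrow> 'g set \<Rightarrow> 'r \<Rightarrow> 'r" where
  "ttr G R K L = trf R (quot G K) (quot G L) (proj G K L)"

definition tnorm ::
  "('g, 'm) monoid_scheme \<Rightarrow> ('g, 'r) tambara_data \<Rightarrow> 'g set \<Rightarrow> 'g set \<Rightarrow> 'r \<Rightarrow> 'r" where
  "tnorm G R K L = nrm R (quot G K) (quot G L) (proj G K L)"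

end

theory Submission
  imports Defs
begin

text \<open>
  Along an isomorphism \<open>\<phi> : H \<rightarrow> H'\<close> every \<open>H\<close>-set \<open>X\<close> is carried to an \<open>H'\<close>-set \<open>T X\<close>,
  obtained by replacing each subset of \<open>H\<close> occurring in a point by its image. The functor \<open>T\<close>
  preserves coproducts, pullbacks and exponential diagrams, so \<open>R \<circ> T\<close> is again a Tambara
  functor, and \<open>T\<close> carries \<open>H/K\<close>, the projections and the conjugations to their counterparts
  for \<open>\<phi> K\<close>.
\<close>

section \<open>Transport along bijections\<close>

text \<open>Conjugation \<open>f \<mapsto> c f b\<^sup>-\<^sup>1\<close>, where \<open>b\<close> is injective on \<open>A\<close>.\<close>

definition push :: "'x set \<Rightarrow> ('x \<Rightarrow> 'u) \<Rightarrow> ('y \<Rightarrow> 'v) \<Rightarrow> ('x \<Rightarrow> 'y) \<Rightarrow> 'u \<Rightarrow> 'v" where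
  "push A b c f = (\<lambda>u\<in>b ` A. c (f (inv_into A b u)))"

lemma push_apply: "\<lbrakk>inj_on b A; x \<in> A\<rbrakk> \<Longrightarrow> push A b c f (b x) = c (f x)"
  by (simp add: push_def)

lemma push_extensional: "push A b c f \<in> extensional (b ` A)"
  by (simp add: push_def)

text \<open>Since \<open>push\<close> is restricted to the image of \<open>A\<close>, it is
  determined by its values at the points \<open>b x\<close>. Every later identification of
  transported maps or actions as equal terms goes through this criterion.\<close>

lemma push_eqI:
  assumes "inj_on b A" "f' \<in> extensional (b ` A)" "\<And>x. x \<in> A \<Longrightarrow> f' (b x) = c (f x)"
  shows "push A b c f = f'"
  using assms by (intro extensionalityI[of _ "b ` A"]) (auto simp: push_def)

lemma push_id: "inj_on b A \<Longrightarrow> push A b b (\<lambda>x\<in>A. x) = (\<lambda>x\<in>b ` A. x)"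
  by (rule push_eqI) auto

text \<open>The middle bijection \<open>c\<close> cancels against its inverse; for this
  \<open>f\<close> has to land in \<open>B\<close>, the set on which \<open>c\<close> is
  inverted.\<close>

lemma push_compose:
  assumes "inj_on b A" "inj_on c B" "f ` A \<subseteq> B"
  shows "push A b d (compose A h f) = compose (b ` A) (push B c d h) (push A b c f)"
  using assms by (intro push_eqI) (auto simp: compose_def push_apply image_subset_iff)

lemma push_bij:
  assumes "bij_betw f A B" "inj_on b A" "inj_on c B"
  shows "bij_betw (push A b c f) (b ` A) (c ` B)"
proof -
  have "bij_betw (c \<circ> f \<circ> inv_into A b) (b ` A) (c ` B)"
    using assms by (intro bij_betw_trans[of _ _ A] bij_betw_trans[of _ _ B])
      (auto simp: inj_on_imp_bij_betw bij_betw_inv_into)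
  then show ?thesis
    by (rule bij_betw_cong[THEN iffD1, rotated]) (simp add: push_def)
qed

section \<open>Twisted isomorphisms of sets with a group action\<close>

locale group_isomorphism = group_hom G H \<phi> for G (structure) and H (structure) and \<phi> +
  assumes bij: "bij_betw \<phi> (carrier G) (carrier H)"
begin

lemma image_carrier: "carrier H = \<phi> ` carrier G"
  using bij by (simp add: bij_betw_def)

lemma inj: "inj_on \<phi> (carrier G)"
  using bij by (simp add: bij_betw_def)

text \<open>Of the action axioms only closure of the points of \<open>X\<close> is built in.
  Together with the free point types this lets the notion apply to fibre products and dependent
  products without first showing that they are sets with a group action.\<close>

definition twisted_iso :: "('a, 'x) gset \<Rightarrow> ('c, 'u) gset \<Rightarrow> ('x \<Rightarrow> 'u) \<Rightarrow> bool" where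
  "twisted_iso X X' b \<longleftrightarrow> bij_betw b (pts X) (pts X') \<and>
    (\<forall>g\<in>carrier G. \<forall>x\<in>pts X. act X g x \<in> pts X \<and> b (act X g x) = act X' (\<phi> g) (b x))"

lemma twisted_isoD:
  assumes "twisted_iso X X' b"
  shows "pts X' = b ` pts X" "inj_on b (pts X)"
    "\<And>g x. \<lbrakk>g \<in> carrier G; x \<in> pts X\<rbrakk> \<Longrightarrow> act X g x \<in> pts X"
    "\<And>g x. \<lbrakk>g \<in> carrier G; x \<in> pts X\<rbrakk> \<Longrightarrow> act X' (\<phi> g) (b x) = b (act X g x)"
  using assms by (auto simp: twisted_iso_def bij_betw_def)

text \<open>Every element of \<open>carrier H\<close> is some \<open>\<phi> g\<close> and every
  point of \<open>X'\<close> is some \<open>b x\<close>, so equivariance has to be checked only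
  there, where it is the image under \<open>c\<close> of the equivariance of
  \<open>f\<close>.\<close>

lemma push_gmaps:
  assumes X: "twisted_iso X X' b" and Y: "twisted_iso Y Y' c" and f: "f \<in> gmaps G X Y"
  shows "push (pts X) b c f \<in> gmaps H X' Y'"
proof -
  have fX: "f x \<in> pts Y" if "x \<in> pts X" for x
    using f that by (auto simp: gmaps_def)
  have "push (pts X) b c f \<in> pts X' \<rightarrow>\<^sub>E pts Y'"
    using fX twisted_isoD(1,2)[OF X] twisted_isoD(1)[OF Y]
    by (auto simp: PiE_def push_extensional push_apply)
  moreover have "push (pts X) b c f (act X' (\<phi> g) (b x)) = act Y' (\<phi> g) (push (pts X) b c f (b x))"
    if "g \<in> carrier G" "x \<in> pts X" for g x
    using that fX f by (simp add: push_apply twisted_isoD[OF X] twisted_isoD[OF Y] gmaps_def)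
  ultimately show ?thesis
    by (simp add: gmaps_def image_carrier twisted_isoD(1)[OF X])
qed

lemma push_gisos:
  assumes X: "twisted_iso X X' b" and Y: "twisted_iso Y Y' c" and f: "f \<in> gisos G X Y"
  shows "push (pts X) b c f \<in> gisos H X' Y'"
  using assms push_gmaps[OF X Y, of f] twisted_isoD(1,2)[OF X] twisted_isoD(1,2)[OF Y]
  by (auto simp: gisos_def intro: push_bij)

text \<open>Each \<open>act X' (\<phi> g)\<close> is the conjugate of the permutation
  \<open>act X g\<close> by \<open>b\<close>, hence a permutation, and products are respected
  because \<phi> is multiplicative. The extensionality hypothesis is there because
  \<open>Bij\<close> contains only extensional functions.\<close>

lemma twisted_iso_group_action:
  assumes X: "twisted_iso X X' b" and grp: "group_action G (pts X) (act X)"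
    and ext: "\<And>g. g \<in> carrier H \<Longrightarrow> act X' g \<in> extensional (pts X')"
  shows "group_action H (pts X') (act X')"
proof -
  interpret A: group_action G "pts X" "act X" by (fact grp)
  have eq: "act X' (\<phi> g) = push (pts X) b b (act X g)" if "g \<in> carrier G" for g
    using twisted_isoD[OF X] that ext by (intro push_eqI[symmetric]) auto
  have bij: "bij_betw (act X g) (pts X) (pts X)" if "g \<in> carrier G" for g
    using A.bij_prop0[OF that] by (simp add: Bij_def)
  have "act X' \<in> hom H (BijGroup (pts X'))"
  proof (rule homI)
    fix g assume "g \<in> carrier H"
    then obtain k where k: "k \<in> carrier G" "g = \<phi> k" by (auto simp: image_carrier)
    have "bij_betw (act X' g) (pts X') (pts X')"
      using push_bij[OF bij[OF k(1)] twisted_isoD(2)[OF X] twisted_isoD(2)[OF X]] k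
      by (simp add: eq twisted_isoD(1)[OF X])
    then show "act X' g \<in> carrier (BijGroup (pts X'))"
      using ext k by (simp add: BijGroup_def Bij_def)
  next
    fix g g' assume "g \<in> carrier H" "g' \<in> carrier H"
    then obtain k k' where k: "k \<in> carrier G" "g = \<phi> k" "k' \<in> carrier G" "g' = \<phi> k'"
      by (auto simp: image_carrier)
    \<comment> \<open>The multiplication of \<open>BijGroup\<close> is composition only between
      members of \<open>Bij\<close>, so both factors must be known to lie there before it can be
      unfolded.\<close>
    have B: "act X' (\<phi> l) \<in> Bij (pts X')" if "l \<in> carrier G" for l
      using push_bij[OF bij[OF that] twisted_isoD(2)[OF X] twisted_isoD(2)[OF X]] ext that
      by (simp add: Bij_def eq[symmetric] twisted_isoD(1)[OF X])
    have "act X' (\<phi> (k \<otimes> k')) = compose (pts X') (act X' (\<phi> k)) (act X' (\<phi> k'))"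
    proof (rule extensionalityI[of _ "pts X'"])
      show "act X' (\<phi> (k \<otimes> k')) x' = compose (pts X') (act X' (\<phi> k)) (act X' (\<phi> k')) x'"
        if x': "x' \<in> pts X'" for x'
      proof -
        obtain x where x: "x \<in> pts X" "x' = b x" using x' twisted_isoD(1)[OF X] by auto
        have "act X (k \<otimes> k') x = act X k (act X k' x)"
          using A.composition_rule[OF x(1) k(1,3)] .
        then show ?thesis
          using k x x' by (simp add: compose_def twisted_isoD(3,4)[OF X] del: hom_mult)
      qed
    qed (use ext k in auto)
    then show "act X' (g \<otimes>\<^bsub>H\<^esub> g') = act X' g \<otimes>\<^bsub>BijGroup (pts X')\<^esub> act X' g'"
      using k B by (simp add: BijGroup_def)
  qed
  then show ?thesis
    by (simp add: group_action_def group_hom_def group_hom_axioms_def group_BijGroup)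
qed

section \<open>Preservation of coproducts, pullbacks and exponential diagrams\<close>

lemma push_coproduct:
  assumes X: "twisted_iso X X' a" and Y: "twisted_iso Y Y' b" and Z: "twisted_iso Z Z' c"
    and co: "is_coproduct G X Y Z i j"
  shows "is_coproduct H X' Y' Z' (push (pts X) a c i) (push (pts Y) b c j)"
proof -
  have i: "i \<in> gmaps G X Z" and j: "j \<in> gmaps G Y Z"
    using co by (auto simp: is_coproduct_def)
  then have iZ: "i ` pts X \<subseteq> pts Z" and jZ: "j ` pts Y \<subseteq> pts Z"
    by (auto simp: gmaps_def)
  \<comment> \<open>The transported inclusions have as images the \<open>c\<close>-images of the
    original ones. These stay disjoint because \<open>c\<close> is injective, and they cover
    \<open>Z'\<close> because \<open>c\<close> is onto.\<close>
  have im: "push (pts X) a c i ` pts X' = c ` i ` pts X" "push (pts Y) b c j ` pts Y' = c ` j ` pts Y"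
    by (auto simp: twisted_isoD(1)[OF X] twisted_isoD(1)[OF Y] image_image
        push_apply twisted_isoD(2)[OF X] twisted_isoD(2)[OF Y])
  have "bij_betw (push (pts X) a c i) (a ` pts X) (c ` i ` pts X)"
    "bij_betw (push (pts Y) b c j) (b ` pts Y) (c ` j ` pts Y)"
    using co twisted_isoD(2)[OF X] twisted_isoD(2)[OF Y] inj_on_subset[OF twisted_isoD(2)[OF Z]] iZ jZ
    by (auto intro!: push_bij inj_on_imp_bij_betw simp: is_coproduct_def)
  then have "inj_on (push (pts X) a c i) (pts X')" "inj_on (push (pts Y) b c j) (pts Y')"
    by (simp_all add: bij_betw_def twisted_isoD(1)[OF X] twisted_isoD(1)[OF Y])
  moreover have "c ` i ` pts X \<inter> c ` j ` pts Y = {}"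
    using co inj_on_image_Int[OF twisted_isoD(2)[OF Z] iZ jZ] by (simp add: is_coproduct_def)
  moreover have "c ` i ` pts X \<union> c ` j ` pts Y = pts Z'"
    using co by (simp add: is_coproduct_def twisted_isoD(1)[OF Z] flip: image_Un)
  ultimately show ?thesis
    using push_gmaps[OF X Z i] push_gmaps[OF Y Z j] by (simp add: is_coproduct_def im)
qed

text \<open>Injectivity of \<open>c\<close> makes the matching condition over \<open>Y\<close>
  equivalent to the transported one. The conditions on \<open>h\<close> and \<open>h'\<close> are
  pointwise instead of membership in \<open>gmaps\<close>, because for exponential diagrams both are
  \<open>fst\<close>, which is not restricted to the points of its domain.\<close>

lemma twisted_iso_fibre_product:
  assumes X: "twisted_iso X X' a" and Z: "twisted_iso Z Z' b" and c: "inj_on c (pts Y)"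
    and f: "f \<in> gmaps G X Y" and hY: "\<And>z. z \<in> pts Z \<Longrightarrow> h z \<in> pts Y"
    and h: "\<And>g z. \<lbrakk>g \<in> carrier G; z \<in> pts Z\<rbrakk> \<Longrightarrow> h (act Z g z) = act Y g (h z)"
    and f': "\<And>x. x \<in> pts X \<Longrightarrow> f' (a x) = c (f x)"
    and h': "\<And>z. z \<in> pts Z \<Longrightarrow> h' (b z) = c (h z)"
  shows "twisted_iso (fibre_product G X f Z h) (fibre_product H X' f' Z' h') (map_prod a b)"
proof -
  let ?P = "{(x, z). x \<in> pts X \<and> z \<in> pts Z \<and> f x = h z}"
  have fY: "f x \<in> pts Y" if "x \<in> pts X" for x using f that by (auto simp: gmaps_def)
  have P': "{(x, z). x \<in> pts X' \<and> z \<in> pts Z' \<and> f' x = h' z} = map_prod a b ` ?P"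
  proof -
    have "c (f x) = c (h z) \<longleftrightarrow> f x = h z" if "x \<in> pts X" "z \<in> pts Z" for x z
      using that c fY hY by (auto dest: inj_onD)
    then show ?thesis
      by (force simp: twisted_isoD(1)[OF X] twisted_isoD(1)[OF Z] f' h')
  qed
  have "inj_on (map_prod a b) ?P"
    using map_prod_inj_on[OF twisted_isoD(2)[OF X] twisted_isoD(2)[OF Z]]
    by (rule inj_on_subset) auto
  moreover have "map_prod a b p \<in> map_prod a b ` ?P" if "p \<in> ?P" for p
    using that by (rule imageI)
  moreover have "f (act X g x) = act Y g (f x)" if "g \<in> carrier G" "x \<in> pts X" for g x
    using f that by (simp add: gmaps_def)
  ultimately show ?thesis
    unfolding twisted_iso_def bij_betw_def fibre_product_def P' Let_def
    by (auto simp: h twisted_isoD(3,4)[OF X] twisted_isoD(3,4)[OF Z])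
qed

lemma push_pullback:
  assumes W: "twisted_iso W W' w" and X: "twisted_iso X X' x" and Z: "twisted_iso Z Z' z"
    and Y: "twisted_iso Y Y' y" and pb: "is_pullback G W X Z Y a b f h"
  shows "is_pullback H W' X' Z' Y' (push (pts W) w x a) (push (pts W) w z b)
    (push (pts X) x y f) (push (pts Z) z y h)"
proof -
  let ?p = "\<lambda>v\<in>pts W. (a v, b v)"
  have g: "a \<in> gmaps G W X" "b \<in> gmaps G W Z" "f \<in> gmaps G X Y" "h \<in> gmaps G Z Y"
    "?p \<in> gisos G W (fibre_product G X f Z h)"
    using pb by (simp_all only: is_pullback_def)
  have "twisted_iso (fibre_product G X f Z h)
    (fibre_product H X' (push (pts X) x y f) Z' (push (pts Z) z y h)) (map_prod x z)"
    using X Z twisted_isoD(2)[OF Y] g(3)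
    by (rule twisted_iso_fibre_product)
      (use g(4) in \<open>auto simp: gmaps_def push_apply twisted_isoD(2)[OF X] twisted_isoD(2)[OF Z]\<close>)
  from push_gisos[OF W this g(5)]
  have "push (pts W) w (map_prod x z) ?p
    \<in> gisos H W' (fibre_product H X' (push (pts X) x y f) Z' (push (pts Z) z y h))" .
  \<comment> \<open>Pushing the pairing of \<open>a\<close> and \<open>b\<close> gives the pairing
    of the pushed maps, so the isomorphism just obtained is the one that \<open>is_pullback\<close>
    asks for.\<close>
  moreover have "push (pts W) w (map_prod x z) ?p
      = (\<lambda>v\<in>pts W'. (push (pts W) w x a v, push (pts W) w z b v))"
    by (rule push_eqI) (auto simp: twisted_isoD(1,2)[OF W] push_apply)
  ultimately show ?thesis
    using push_gmaps[OF W X g(1)] push_gmaps[OF W Z g(2)] push_gmaps[OF X Y g(3)] push_gmaps[OF Z Y g(4)]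
    by (simp add: is_pullback_def)
qed

text \<open>A section over the fibre at \<open>y\<close> is conjugated by \<open>b\<close> and
  \<open>a\<close> into a section over the fibre at \<open>c y\<close>. The action axioms for
  \<open>X\<close> and \<open>Y\<close> are assumed because \<open>g\<close> acts on sections
  through its inverse, which must undo \<open>g\<close> on points and fibres.\<close>

lemma twisted_iso_dependent_product:
  assumes A: "twisted_iso A A' a" and X: "twisted_iso X X' b" and Y: "twisted_iso Y Y' c"
    and aX: "group_action G (pts X) (act X)" and aY: "group_action G (pts Y) (act Y)"
    and q: "q \<in> gmaps G A X" and f: "f \<in> gmaps G X Y"
    and q': "\<And>z. z \<in> pts A \<Longrightarrow> q' (a z) = b (q z)"
    and f': "\<And>x. x \<in> pts X \<Longrightarrow> f' (b x) = c (f x)"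
  shows "twisted_iso (dependent_product G A q X f Y) (dependent_product H A' q' X' f' Y')
    (\<lambda>(y, s). (c y, push {x \<in> pts X. f x = y} b a s))"
proof -
  interpret aX: group_action G "pts X" "act X" by (fact aX)
  interpret aY: group_action G "pts Y" "act Y" by (fact aY)
  define F where "F = (\<lambda>y. {x \<in> pts X. f x = y})"
  define F' where "F' = (\<lambda>y. {x \<in> pts X'. f' x = y})"
  define \<delta> where "\<delta> = (\<lambda>(y, s). (c y, push (F y) b a s))"
  define P where "P = {(y, s). y \<in> pts Y \<and> s \<in> F y \<rightarrow>\<^sub>E pts A \<and> (\<forall>x\<in>F y. q (s x) = x)}"
  define P' where "P' = {(y, s). y \<in> pts Y' \<and> s \<in> F' y \<rightarrow>\<^sub>E pts A' \<and> (\<forall>x\<in>F' y. q' (s x) = x)}"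
  note inj_a = twisted_isoD(2)[OF A] and inj_b = twisted_isoD(2)[OF X]
    and inj_c = twisted_isoD(2)[OF Y]
  have FX: "x \<in> pts X" if "x \<in> F y" for x y
    using that by (simp add: F_def)
  have inj_F: "inj_on b (F y)" for y
    using inj_b by (rule inj_on_subset) (auto simp: F_def)
  have fY: "f x \<in> pts Y" if "x \<in> pts X" for x using f that by (auto simp: gmaps_def)
  \<comment> \<open>The domain of a pushed section is the whole fibre over \<open>c y\<close>,
    because \<open>c\<close> separates the points of \<open>Y\<close>.\<close>
  have F'_eq: "F' (c y) = b ` F y" if "y \<in> pts Y" for y
  proof -
    have "c (f x) = c y \<longleftrightarrow> f x = y" if "x \<in> pts X" for x
      using inj_c fY[OF that] \<open>y \<in> pts Y\<close> by (auto dest: inj_onD)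
    then show ?thesis by (auto simp: F_def F'_def f' twisted_isoD(1)[OF X])
  qed
  have "inj_on \<delta> P"
  proof (rule inj_onI)
    fix p p' assume *: "p \<in> P" "p' \<in> P" "\<delta> p = \<delta> p'"
    obtain y s z r where p: "p = (y, s)" "p' = (z, r)" by (cases p; cases p')
    have y: "y = z" using * p inj_c by (auto simp: \<delta>_def P_def dest: inj_onD)
    have "s x = r x" if "x \<in> F y" for x
    proof -
      have "push (F y) b a s (b x) = push (F y) b a r (b x)" using * p y by (simp add: \<delta>_def)
      then have "a (s x) = a (r x)" using that inj_F by (simp add: push_apply)
      moreover have "s x \<in> pts A" "r x \<in> pts A" using * p y that by (auto simp: P_def)
      ultimately show ?thesis using inj_a by (auto dest: inj_onD)
    qed
    then have "s = r" using * p y by (intro extensionalityI[of _ "F y"]) (auto simp: P_def PiE_def)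
    then show "p = p'" using p y by simp
  qed
  moreover have "\<delta> ` P \<subseteq> P'"
  proof (rule image_subsetI)
    fix p assume "p \<in> P"
    then obtain y s where p: "p = (y, s)" and *: "(y, s) \<in> P" by (cases p) auto
    then have "y \<in> pts Y" by (simp add: P_def)
    have "q' (a (s x)) = b x" "a (s x) \<in> pts A'" if "x \<in> F y" for x
    proof -
      have "s x \<in> pts A" "q (s x) = x" using * that by (auto simp: P_def)
      then show "q' (a (s x)) = b x" "a (s x) \<in> pts A'" by (simp_all add: q' twisted_isoD(1)[OF A])
    qed
    then show "\<delta> p \<in> P'"
      using \<open>y \<in> pts Y\<close>
      by (auto simp: p \<delta>_def P'_def F'_eq push_apply inj_F PiE_def push_extensional twisted_isoD(1)[OF Y])
  qed
  moreover have "P' \<subseteq> \<delta> ` P"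
  proof (rule subsetI)
    fix p assume "p \<in> P'"
    then obtain y' s' where p: "p = (y', s')" and *: "(y', s') \<in> P'" by (cases p) auto
    then obtain y where y: "y \<in> pts Y" "y' = c y" by (auto simp: P'_def twisted_isoD(1)[OF Y])
    \<comment> \<open>The preimage of a section is found by conjugating it back. That
      \<open>s\<close> is a section of \<open>q\<close> follows from injectivity of
      \<open>b\<close>, by comparing \<open>b (q (s x))\<close> with \<open>b x\<close>.\<close>
    define s where "s = (\<lambda>x\<in>F y. inv_into (pts A) a (s' (b x)))"
    have s'A: "s' (b x) \<in> a ` pts A" "q' (s' (b x)) = b x" if "x \<in> F y" for x
      using * that y by (auto simp: P'_def F'_eq twisted_isoD(1)[OF A])
    have sA: "s x \<in> pts A" "a (s x) = s' (b x)" if "x \<in> F y" for x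
      using s'A[OF that] that by (auto simp: s_def inv_into_into f_inv_into_f)
    have "q (s x) = x" if "x \<in> F y" for x
    proof -
      have "b (q (s x)) = b x" using q'[OF sA(1)[OF that]] sA(2) s'A(2) that by simp
      moreover have "q (s x) \<in> pts X" using q sA(1)[OF that] by (auto simp: gmaps_def)
      ultimately show ?thesis using inj_b FX[OF that] by (auto dest: inj_onD)
    qed
    then have "(y, s) \<in> P" using sA(1) y by (auto simp: P_def s_def)
    moreover have "push (F y) b a s = s'"
      using * y sA inj_F by (intro push_eqI) (auto simp: P'_def F'_eq PiE_def)
    ultimately show "p \<in> \<delta> ` P" using y p by (force simp: \<delta>_def)
  qed
  ultimately have bij: "bij_betw \<delta> P P'" by (auto simp: bij_betw_def)
  \<comment> \<open>This is the content of equivariance of \<delta>: the translate of a section is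
    again a section, and its push is the translate by \<open>\<phi> g\<close> of the pushed
    section.\<close>
  have equi: "(act Y g y, \<lambda>x\<in>F (act Y g y). act A g (s (act X (inv g) x))) \<in> P \<and>
      push (F (act Y g y)) b a (\<lambda>x\<in>F (act Y g y). act A g (s (act X (inv g) x))) =
      (\<lambda>x\<in>F' (act Y' (\<phi> g) (c y)). act A' (\<phi> g) (push (F y) b a s (act X' (inv\<^bsub>H\<^esub> (\<phi> g)) x)))"
    if g: "g \<in> carrier G" and ys: "(y, s) \<in> P" for g y s
  proof -
    have y: "y \<in> pts Y" using ys by (simp add: P_def)
    have gy: "act Y g y \<in> pts Y" using twisted_isoD(3)[OF Y g y] .
    \<comment> \<open>The inverse of \<open>g\<close> carries the fibre over the translate of
      \<open>y\<close> back to the fibre over \<open>y\<close>, where \<open>s\<close> is defined.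
      The first claim uses the action on \<open>Y\<close>, the second the action on
      \<open>X\<close>.\<close>
    have g_inv: "act X (inv g) x \<in> F y" "act X g (act X (inv g) x) = x"
      if "x \<in> F (act Y g y)" for x
    proof -
      have x: "x \<in> pts X" "f x = act Y g y" using that by (auto simp: F_def)
      have "f (act X (inv g) x) = act Y (inv g) (act Y g y)"
        using f x g by (simp add: gmaps_def)
      also have "\<dots> = y" using aY.orbit_sym_aux[OF g y refl] .
      finally show "act X (inv g) x \<in> F y"
        using twisted_isoD(3)[OF X] x g by (simp add: F_def)
      show "act X g (act X (inv g) x) = x"
        using aX.orbit_sym_aux[OF _ x(1) refl, of "inv g"] g by simp
    qed
    have sec: "s x \<in> pts A" "q (s x) = x" if "x \<in> F y" for x
      using ys that by (auto simp: P_def)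
    have "q (act A g (s (act X (inv g) x))) = x" if "x \<in> F (act Y g y)" for x
      using q g sec[OF g_inv(1)[OF that]] g_inv(2)[OF that] by (simp add: gmaps_def)
    then have "(act Y g y, \<lambda>x\<in>F (act Y g y). act A g (s (act X (inv g) x))) \<in> P"
      using gy twisted_isoD(3)[OF A g] sec(1) g_inv(1) by (auto simp: P_def)
    moreover have "act A' (\<phi> g) (push (F y) b a s (act X' (inv\<^bsub>H\<^esub> (\<phi> g)) (b x)))
        = a (act A g (s (act X (inv g) x)))" if "x \<in> F (act Y g y)" for x
    proof -
      have "act X' (inv\<^bsub>H\<^esub> (\<phi> g)) (b x) = b (act X (inv g) x)"
        using twisted_isoD(4)[OF X, of "inv g" x] g FX[OF that] by simp
      then show ?thesis
        using g_inv(1)[OF that] by (simp add: push_apply inj_F twisted_isoD(4)[OF A g] sec(1))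
    qed
    ultimately show ?thesis
      using gy by (intro conjI push_eqI) (auto simp: inj_F F'_eq twisted_isoD(4)[OF Y g y])
  qed
  let ?D = "dependent_product G A q X f Y" and ?D' = "dependent_product H A' q' X' f' Y'"
  have D: "?D = \<lparr>pts = P, act = (\<lambda>g\<in>carrier G. \<lambda>(y, s)\<in>P.
      (act Y g y, \<lambda>x\<in>F (act Y g y). act A g (s (act X (inv g) x))))\<rparr>"
    and D': "?D' = \<lparr>pts = P', act = (\<lambda>g\<in>carrier H. \<lambda>(y, s)\<in>P'.
      (act Y' g y, \<lambda>x\<in>F' (act Y' g y). act A' g (s (act X' (inv\<^bsub>H\<^esub> g) x))))\<rparr>"
    by (simp_all add: dependent_product_def Let_def P_def P'_def F_def F'_def)
  have \<delta>P: "(c y, push (F y) b a s) \<in> P'" if "(y, s) \<in> P" for y s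
    using bij_betw_apply[OF bij that] by (simp add: \<delta>_def)
  have "twisted_iso ?D ?D' \<delta>"
    unfolding twisted_iso_def
  proof (intro conjI ballI)
    show "bij_betw \<delta> (pts ?D) (pts ?D')" by (simp add: D D' bij)
    fix g p assume g: "g \<in> carrier G" and p: "p \<in> pts ?D"
    obtain y s where ys: "p = (y, s)" "(y, s) \<in> P" using p by (cases p) (auto simp: D)
    then have "y \<in> pts Y" by (simp add: P_def)
    then show "act ?D g p \<in> pts ?D" "\<delta> (act ?D g p) = act ?D' (\<phi> g) (\<delta> p)"
      using equi[OF g ys(2)] g ys \<delta>P[OF ys(2)]
      by (simp_all add: D D' \<delta>_def twisted_isoD(4)[OF Y g])
  qed
  then show ?thesis by (simp add: \<delta>_def F_def)
qed

text \<open>The isomorphisms \<alpha> and \<beta> onto the canonical diagram are pushed along the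
  induced twisted isomorphisms: \<delta> on the dependent product, and
  \<open>map_prod b \<delta>\<close> on the fibre product. The three compatibility equations then
  carry over point by point.\<close>

lemma push_exponential:
  assumes A: "twisted_iso A TA a" and X: "twisted_iso X TX b" and Y: "twisted_iso Y TY c"
    and X': "twisted_iso X' TX' b'" and Y': "twisted_iso Y' TY' c'"
    and aX: "group_action G (pts X) (act X)" and aY: "group_action G (pts Y) (act Y)"
    and ex: "is_exponential G A X Y X' Y' q f e f' q'"
  shows "is_exponential H TA TX TY TX' TY' (push (pts A) a b q) (push (pts X) b c f)
    (push (pts X') b' a e) (push (pts X') b' c' f') (push (pts Y') c' c q')"
proof -
  define D where "D = dependent_product G A q X f Y"
  define D' where "D' = dependent_product H TA (push (pts A) a b q) TX (push (pts X) b c f) TY"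
  define \<delta> where "\<delta> = (\<lambda>(y, s). (c y, push {x \<in> pts X. f x = y} b a s))"
  let ?f' = "push (pts X') b' c' f'"
  have g: "q \<in> gmaps G A X" "f \<in> gmaps G X Y" "e \<in> gmaps G X' A" "f' \<in> gmaps G X' Y'"
    "q' \<in> gmaps G Y' Y"
    using ex by (auto simp: is_exponential_def)
  obtain \<beta> \<alpha> where \<beta>: "\<beta> \<in> gisos G Y' D" and \<alpha>: "\<alpha> \<in> gisos G X' (fibre_product G X f D fst)"
    and \<beta>q: "\<And>v. v \<in> pts Y' \<Longrightarrow> fst (\<beta> v) = q' v"
    and \<alpha>f: "\<And>u. u \<in> pts X' \<Longrightarrow> snd (\<alpha> u) = \<beta> (f' u)"
    and \<alpha>e: "\<And>u. u \<in> pts X' \<Longrightarrow> e u = (snd (snd (\<alpha> u))) (fst (\<alpha> u))"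
    using ex unfolding is_exponential_def D_def by blast
  have D: "twisted_iso D D' \<delta>"
    unfolding D_def D'_def \<delta>_def
    by (rule twisted_iso_dependent_product[OF A X Y aX aY g(1,2)])
      (simp_all add: push_apply twisted_isoD(2)[OF A] twisted_isoD(2)[OF X])
  have E: "twisted_iso (fibre_product G X f D fst) (fibre_product H TX (push (pts X) b c f) D' fst)
      (map_prod b \<delta>)"
    using X D twisted_isoD(2)[OF Y] g(2)
  proof (rule twisted_iso_fibre_product)
    show "fst (act D g z) = act Y g (fst z)" if "g \<in> carrier G" "z \<in> pts D" for g z
      using that by (auto simp: D_def dependent_product_def Let_def)
  qed (auto simp: push_apply twisted_isoD(2)[OF X] \<delta>_def D_def dependent_product_def Let_def)
  have f'Y: "f' u \<in> pts Y'" if "u \<in> pts X'" for u using g(4) that by (auto simp: gmaps_def)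
  have "fst (push (pts Y') c' \<delta> \<beta> v) = push (pts Y') c' c q' v" if "v \<in> pts TY'" for v
    using that \<beta>q by (auto simp: twisted_isoD(1,2)[OF Y'] push_apply \<delta>_def case_prod_beta)
  moreover have "snd (push (pts X') b' (map_prod b \<delta>) \<alpha> u) = push (pts Y') c' \<delta> \<beta> (?f' u)"
    if "u \<in> pts TX'" for u
    using that \<alpha>f f'Y by (auto simp: twisted_isoD(1,2)[OF X'] twisted_isoD(2)[OF Y'] push_apply)
  moreover have "push (pts X') b' a e u = snd (snd (push (pts X') b' (map_prod b \<delta>) \<alpha> u))
      (fst (push (pts X') b' (map_prod b \<delta>) \<alpha> u))" if u: "u \<in> pts TX'" for u
  proof -
    obtain v where v: "v \<in> pts X'" "u = b' v" using u by (auto simp: twisted_isoD(1)[OF X'])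
    obtain x y s where xys: "\<alpha> v = (x, y, s)" by (metis prod_cases3)
    \<comment> \<open>Membership in the fibre product gives \<open>f x = y\<close>, so
      \<open>x\<close> lies in the domain of the section \<open>s\<close>. Only for such
      \<open>x\<close> does evaluating the pushed section at \<open>b x\<close> return
      \<open>a (s x)\<close>.\<close>
    have "\<alpha> v \<in> pts (fibre_product G X f D fst)"
      using \<alpha> v by (auto simp: gisos_def gmaps_def)
    then have x: "x \<in> {x \<in> pts X. f x = y}" by (simp add: xys fibre_product_def Let_def)
    have "inj_on b {x \<in> pts X. f x = y}"
      using twisted_isoD(2)[OF X] by (rule inj_on_subset) auto
    then have "push {x \<in> pts X. f x = y} b a s (b x) = a (s x)"
      using x by (rule push_apply)
    then show ?thesis
      using v \<alpha>e[OF v(1)] xys by (simp add: push_apply twisted_isoD(2)[OF X'] \<delta>_def)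
  qed
  ultimately show ?thesis
    using push_gmaps[OF A X g(1)] push_gmaps[OF X Y g(2)] push_gmaps[OF X' A g(3)]
      push_gmaps[OF X' Y' g(4)] push_gmaps[OF Y' Y g(5)] push_gisos[OF Y' D \<beta>] push_gisos[OF X' E \<alpha>]
    unfolding is_exponential_def D'_def by blast
qed

section \<open>The transport functor\<close>

definition tpt :: "'a point \<Rightarrow> 'c point" where
  "tpt = map_prod id (image \<phi>)"

text \<open>The outer \<open>push\<close> makes \<open>\<phi> g\<close> act as the conjugate of the
  action of \<open>g\<close>. Both levels of \<open>push\<close> give extensional functions, in the
  group element as well as in the point, as \<open>fin_gsets H\<close> demands.\<close>

definition tset :: "('a, 'a point) gset \<Rightarrow> ('c, 'c point) gset" where
  "tset X = \<lparr>pts = tpt ` pts X, act = push (carrier G) \<phi> (push (pts X) tpt tpt) (act X)\<rparr>"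

definition tmap :: "('a, 'a point) gset \<Rightarrow> ('a point \<Rightarrow> 'a point) \<Rightarrow> 'c point \<Rightarrow> 'c point" where
  "tmap X = push (pts X) tpt tpt"

text \<open>The composite of \<open>R\<close> with the transport functor, given on all finite
  \<open>G\<close>-sets. The prescribed values on orbits are recovered from
  \<open>tset_quot\<close>.\<close>

definition pullback_data :: "('c, 'r) tambara_data \<Rightarrow> ('a, 'r) tambara_data" where
  "pullback_data R = \<lparr>level = \<lambda>X. level R (tset X),
     rst = \<lambda>X Y f. rst R (tset X) (tset Y) (tmap X f),
     trf = \<lambda>X Y f. trf R (tset X) (tset Y) (tmap X f),
     nrm = \<lambda>X Y f. nrm R (tset X) (tset Y) (tmap X f)\<rparr>"

text \<open>Injectivity of \<phi> is known only on \<open>carrier G\<close>; the subsets occurring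
  in points of objects of \<open>fin_gsets G\<close> lie inside it.\<close>

lemma inj_on_tpt: "inj_on tpt (UNIV \<times> Pow (carrier G))"
  unfolding tpt_def by (intro map_prod_inj_on) (auto intro: inj_on_image_Pow inj)

lemma twisted_iso_tset:
  assumes "pts X \<subseteq> UNIV \<times> Pow (carrier G)"
    "\<And>g x. \<lbrakk>g \<in> carrier G; x \<in> pts X\<rbrakk> \<Longrightarrow> act X g x \<in> pts X"
  shows "twisted_iso X (tset X) tpt"
  using assms(2) inj_on_subset[OF inj_on_tpt assms(1)]
  by (simp add: twisted_iso_def tset_def push_apply inj inj_on_imp_bij_betw)

lemma fin_gsets_twisted_iso:
  assumes "X \<in> fin_gsets G"
  shows "twisted_iso X (tset X) tpt"
proof (rule twisted_iso_tset)
  interpret group_action G "pts X" "act X" using assms by (simp add: fin_gsets_def)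
  show "act X g x \<in> pts X" if "g \<in> carrier G" "x \<in> pts X" for g x
    by (rule element_image[OF that refl])
qed (use assms in \<open>simp add: fin_gsets_def\<close>)

lemma tset_fin_gsets:
  assumes X: "X \<in> fin_gsets G"
  shows "tset X \<in> fin_gsets H"
proof -
  have "group_action H (pts (tset X)) (act (tset X))"
    using fin_gsets_twisted_iso[OF X]
  proof (rule twisted_iso_group_action)
    show "act (tset X) g \<in> extensional (pts (tset X))" if "g \<in> carrier H" for g
      using that by (auto simp: image_carrier tset_def push_apply inj push_extensional)
  qed (use X in \<open>simp add: fin_gsets_def\<close>)
  moreover have "tpt ` pts X \<subseteq> UNIV \<times> Pow (carrier H)"
    using X by (fastforce simp: fin_gsets_def tpt_def)
  ultimately show ?thesis
    using X by (auto simp: fin_gsets_def tset_def image_carrier push_extensional)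
qed

text \<open>The twisted isomorphism fixes the points of \<open>Y\<close> and the action of each
  \<open>\<phi> g\<close> on them; extensionality in both arguments leaves no freedom elsewhere. The
  result is equality of objects and not merely an isomorphism.\<close>

lemma tset_eqI:
  assumes X: "twisted_iso X Y tpt" and ext: "act Y \<in> extensional (carrier H)"
    "\<And>g. g \<in> carrier H \<Longrightarrow> act Y g \<in> extensional (pts Y)"
  shows "tset X = Y"
proof -
  have "push (carrier G) \<phi> (push (pts X) tpt tpt) (act X) = act Y"
    using ext twisted_isoD[OF X] inj
    by (intro push_eqI) (auto simp: image_carrier intro!: push_eqI[symmetric])
  then show ?thesis by (simp add: tset_def twisted_isoD(1)[OF X])
qed

section \<open>Functoriality of the transport on maps and on diagrams\<close>

lemma tmap_gmaps:
  "\<lbrakk>X \<in> fin_gsets G; Y \<in> fin_gsets G; f \<in> gmaps G X Y\<rbrakk> \<Longrightarrow> tmap X f \<in> gmaps H (tset X) (tset Y)"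
  unfolding tmap_def by (rule push_gmaps; (erule fin_gsets_twisted_iso | assumption))

lemma tmap_id: "X \<in> fin_gsets G \<Longrightarrow> tmap X (\<lambda>x\<in>pts X. x) = (\<lambda>x\<in>pts (tset X). x)"
  unfolding tmap_def using twisted_isoD(1,2)[OF fin_gsets_twisted_iso] by (simp add: push_id)

lemma tmap_compose:
  assumes "X \<in> fin_gsets G" "Y \<in> fin_gsets G" "f \<in> gmaps G X Y"
  shows "tmap X (compose (pts X) h f) = compose (pts (tset X)) (tmap Y h) (tmap X f)"
  using assms twisted_isoD(1,2)[OF fin_gsets_twisted_iso] unfolding tmap_def
  by (subst push_compose) (auto simp: gmaps_def)

lemma tmap_coproduct:
  "\<lbrakk>X \<in> fin_gsets G; Y \<in> fin_gsets G; Z \<in> fin_gsets G; is_coproduct G X Y Z i j\<rbrakk>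
    \<Longrightarrow> is_coproduct H (tset X) (tset Y) (tset Z) (tmap X i) (tmap Y j)"
  unfolding tmap_def by (rule push_coproduct; (erule fin_gsets_twisted_iso | assumption))

lemma tmap_pullback:
  "\<lbrakk>W \<in> fin_gsets G; X \<in> fin_gsets G; Z \<in> fin_gsets G; Y \<in> fin_gsets G; is_pullback G W X Z Y a b f h\<rbrakk>
    \<Longrightarrow> is_pullback H (tset W) (tset X) (tset Z) (tset Y) (tmap W a) (tmap W b) (tmap X f) (tmap Z h)"
  unfolding tmap_def by (rule push_pullback; (erule fin_gsets_twisted_iso | assumption))

lemma tmap_exponential:
  "\<lbrakk>A \<in> fin_gsets G; X \<in> fin_gsets G; Y \<in> fin_gsets G; X' \<in> fin_gsets G; Y' \<in> fin_gsets G;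
      is_exponential G A X Y X' Y' q f e f' q'\<rbrakk>
    \<Longrightarrow> is_exponential H (tset A) (tset X) (tset Y) (tset X') (tset Y')
          (tmap A q) (tmap X f) (tmap X' e) (tmap X' f') (tmap Y' q')"
  unfolding tmap_def
  by (rule push_exponential; (erule fin_gsets_twisted_iso | simp add: fin_gsets_def))

text \<open>Each axiom is the corresponding axiom of \<open>R\<close> at the transported objects and
  maps, since transport respects identities, composition and the three kinds of diagrams.\<close>

lemma pullback_tambara_functor:
  assumes "tambara_functor H R"
  shows "tambara_functor G (pullback_data R)"
proof -
  interpret R: tambara_functor H R by (fact assms)
  note T = tset_fin_gsets tmap_gmaps
  show ?thesis
  \<comment> \<open>The seventeen cases are the axioms of \<open>tambara_functor\<close> in the
    order of their declaration, from finiteness of the group to \<open>nrm_trf\<close>.\<close>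
  proof (rule tambara_functor.intro[OF G.is_group], rule tambara_functor_axioms.intro,
      unfold pullback_data_def tambara_data.simps, goal_cases)
    case 1 then show ?case using R.finite_group bij by (simp add: bij_betw_finite)
  next
    case 2 then show ?case by (intro R.level_cring T)
  next
    case 3 then show ?case by (intro R.rst_hom T)
  next
    case 4 then show ?case by (intro R.trf_hom T)
  next
    case 5 then show ?case by (intro R.nrm_hom T)
  next
    case 6 then show ?case by (intro R.nrm_one T)
  next
    case 7 then show ?case by (simp add: R.rst_id T tmap_id)
  next
    case 8 then show ?case by (simp add: R.trf_id T tmap_id)
  next
    case 9 then show ?case by (simp add: R.nrm_id T tmap_id)
  next
    case (10 X Y Z f h a)
    then show ?case
      using R.rst_comp[of "tset X" "tset Y" "tset Z" "tmap X f" "tmap Y h"] by (simp add: T tmap_compose)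
  next
    case (11 X Y Z f h a)
    then show ?case
      using R.trf_comp[of "tset X" "tset Y" "tset Z" "tmap X f" "tmap Y h"] by (simp add: T tmap_compose)
  next
    case (12 X Y Z f h a)
    then show ?case
      using R.nrm_comp[of "tset X" "tset Y" "tset Z" "tmap X f" "tmap Y h"] by (simp add: T tmap_compose)
  next
    case (13 X) then show ?case using R.level_empty[of "tset X"] T(1)[of X] twisted_isoD(1)[OF fin_gsets_twisted_iso] by simp
  next
    case 14 then show ?case by (intro R.level_coproduct T tmap_coproduct)
  next
    case 15 then show ?case by (intro R.rst_trf T) (auto intro: tmap_pullback)
  next
    case 16 then show ?case by (intro R.rst_nrm T) (auto intro: tmap_pullback)
  next
    case 17 then show ?case by (intro R.nrm_trf T) (auto intro: tmap_exponential)
  qed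
qed

section \<open>Transport of orbits\<close>

text \<open>Cosets are products with a singleton, so this identity serves for left and right cosets,
  conjugate subgroups and projections alike.\<close>

lemma image_set_mult:
  assumes "C \<subseteq> carrier G" "L \<subseteq> carrier G"
  shows "\<phi> ` (C <#> L) = \<phi> ` C <#>\<^bsub>H\<^esub> \<phi> ` L"
proof -
  have "\<phi> (x \<otimes> y) = \<phi> x \<otimes>\<^bsub>H\<^esub> \<phi> y" if "x \<in> C" "y \<in> L" for x y
    using assms that by (intro hom_mult) auto
  then show ?thesis by (simp add: set_mult_def image_UN)
qed

lemma image_l_coset: "\<lbrakk>g \<in> carrier G; C \<subseteq> carrier G\<rbrakk> \<Longrightarrow> \<phi> ` (g <# C) = \<phi> g <#\<^bsub>H\<^esub> \<phi> ` C"
  unfolding l_coset_eq_set_mult by (subst image_set_mult) simp_all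

lemma image_r_coset: "\<lbrakk>g \<in> carrier G; C \<subseteq> carrier G\<rbrakk> \<Longrightarrow> \<phi> ` (C #> g) = \<phi> ` C #>\<^bsub>H\<^esub> \<phi> g"
  unfolding r_coset_eq_set_mult by (subst image_set_mult) simp_all

lemma image_conj_subgroup:
  assumes "g \<in> carrier G" "K \<subseteq> carrier G"
  shows "\<phi> ` conj_subgroup G g K = conj_subgroup H (\<phi> g) (\<phi> ` K)"
  using assms by (simp add: conj_subgroup_def image_r_coset image_l_coset G.l_coset_subset_G)

lemma pts_quot_subset: "K \<subseteq> carrier G \<Longrightarrow> pts (quot G K) \<subseteq> UNIV \<times> Pow (carrier G)"
  by (auto simp: quot_def Let_def LCOSETS_def dest: G.l_coset_subset_G)

text \<open>The number component stays 0 and the coset of \<open>g\<close> modulo \<open>K\<close>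
  goes to the coset of \<open>\<phi> g\<close> modulo the image of \<open>K\<close>. Surjectivity of
  \<phi> ensures that all cosets on the other side arise.\<close>

lemma twisted_iso_quot:
  assumes K: "K \<subseteq> carrier G"
  shows "twisted_iso (quot G K) (quot H (\<phi> ` K)) tpt"
proof -
  have img: "tpt ` ({0} \<times> (lcosets K)) = {0} \<times> (lcosets\<^bsub>H\<^esub> (\<phi> ` K))"
  proof -
    have "lcosets\<^bsub>H\<^esub> (\<phi> ` K) = (\<Union>g\<in>carrier G. {\<phi> ` (g <# K)})"
      using K by (simp add: LCOSETS_def image_carrier image_l_coset)
    also have "\<dots> = image \<phi> ` (lcosets K)"
      by (auto simp: LCOSETS_def)
    finally show ?thesis unfolding tpt_def by (intro map_prod_surj_on) auto
  qed
  \<comment> \<open>Translating the coset of \<open>k\<close> by \<open>g\<close> gives the coset of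
    \<open>g \<otimes> k\<close>.\<close>
  have closed: "g <# C \<in> lcosets K" if "g \<in> carrier G" "C \<in> lcosets K" for g C
  proof -
    obtain k where k: "k \<in> carrier G" "C = k <# K" using \<open>C \<in> lcosets K\<close> by (auto simp: LCOSETS_def)
    then have "g <# C = (g \<otimes> k) <# K" using K \<open>g \<in> carrier G\<close> by (simp add: G.lcos_m_assoc)
    then show ?thesis using k \<open>g \<in> carrier G\<close> by (auto simp: LCOSETS_def)
  qed
  have sub: "C \<subseteq> carrier G" if "C \<in> lcosets K" for C
    using that K by (auto simp: LCOSETS_def dest: G.l_coset_subset_G)
  have "inj_on tpt ({0} \<times> (lcosets K))"
    using sub by (intro inj_on_subset[OF inj_on_tpt]) auto
  moreover have "tpt p \<in> {0} \<times> (lcosets\<^bsub>H\<^esub> (\<phi> ` K))" if "p \<in> {0} \<times> (lcosets K)" for p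
    using that img by blast
  ultimately show ?thesis
    using closed sub
    by (auto simp: twisted_iso_def quot_def Let_def bij_betw_def img)
      (auto simp: tpt_def image_l_coset)
qed

text \<open>The action of \<open>quot\<close> is restricted in both arguments, so
  \<open>tset_eqI\<close> applies. This literal equality is what lets levels and structure maps on
  orbits agree as terms.\<close>

lemma tset_quot: "K \<subseteq> carrier G \<Longrightarrow> tset (quot G K) = quot H (\<phi> ` K)"
  by (intro tset_eqI twisted_iso_quot) (auto simp: quot_def Let_def)

text \<open>Projection multiplies a coset by \<open>L\<close> on the right, and \<phi> preserves
  products of subsets.\<close>

lemma tmap_proj:
  assumes "K \<subseteq> carrier G" "L \<subseteq> carrier G"
  shows "tmap (quot G K) (proj G K L) = proj H (\<phi> ` K) (\<phi> ` L)"
  unfolding tmap_def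
proof (rule push_eqI)
  note Q = twisted_isoD(1,2)[OF twisted_iso_quot[OF assms(1)]]
  show "inj_on tpt (pts (quot G K))" by (fact Q(2))
  show "proj H (\<phi> ` K) (\<phi> ` L) \<in> extensional (tpt ` pts (quot G K))"
    by (simp add: proj_def Q(1))
  show "proj H (\<phi> ` K) (\<phi> ` L) (tpt x) = tpt (proj G K L x)" if x: "x \<in> pts (quot G K)" for x
  proof -
    have "tpt x \<in> pts (quot H (\<phi> ` K))" using x Q(1) by blast
    moreover obtain n C where "x = (n, C)" "C \<subseteq> carrier G"
      using x pts_quot_subset[OF assms(1)] by (cases x) auto
    ultimately show ?thesis
      using x assms(2) by (simp add: proj_def tpt_def image_set_mult)
  qed
qed

text \<open>The map multiplies a coset by \<open>g\<close> on the right, which \<phi> turns into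
  multiplication by \<open>\<phi> g\<close>. The domains match because \<phi> carries the conjugate
  of \<open>K\<close> by \<open>g\<close> to the conjugate of its image by
  \<open>\<phi> g\<close>.\<close>

lemma tmap_conj_map:
  assumes "g \<in> carrier G" "K \<subseteq> carrier G"
  shows "tmap (quot G (conj_subgroup G g K)) (conj_map G g K) = conj_map H (\<phi> g) (\<phi> ` K)"
  unfolding tmap_def
proof (rule push_eqI)
  have c: "conj_subgroup G g K \<subseteq> carrier G"
    using assms by (simp add: conj_subgroup_def G.l_coset_subset_G G.r_coset_subset_G)
  note Q = twisted_isoD(1,2)[OF twisted_iso_quot[OF c]]
  show "inj_on tpt (pts (quot G (conj_subgroup G g K)))" by (fact Q(2))
  show "conj_map H (\<phi> g) (\<phi> ` K) \<in> extensional (tpt ` pts (quot G (conj_subgroup G g K)))"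
    by (simp add: conj_map_def Q(1)[symmetric] image_conj_subgroup[OF assms])
  show "conj_map H (\<phi> g) (\<phi> ` K) (tpt x) = tpt (conj_map G g K x)"
    if x: "x \<in> pts (quot G (conj_subgroup G g K))" for x
  proof -
    have "tpt x \<in> pts (quot H (conj_subgroup H (\<phi> g) (\<phi> ` K)))"
      using x Q(1) image_conj_subgroup[OF assms] by auto
    moreover obtain n C where "x = (n, C)" "C \<subseteq> carrier G"
      using x pts_quot_subset[OF c] by (cases x) auto
    ultimately show ?thesis
      using x assms(1) by (simp add: conj_map_def tpt_def image_r_coset)
  qed
qed

lemma pullback_level: "K \<subseteq> carrier G \<Longrightarrow> level (pullback_data R) (quot G K) = level R (quot H (\<phi> ` K))"
  by (simp add: pullback_data_def tset_quot)

lemma pullback_tconj: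
  assumes "g \<in> carrier G" "K \<subseteq> carrier G"
  shows "tconj G (pullback_data R) g K = tconj H R (\<phi> g) (\<phi> ` K)"
proof -
  have "conj_subgroup G g K \<subseteq> carrier G"
    using assms by (simp add: conj_subgroup_def G.l_coset_subset_G G.r_coset_subset_G)
  then show ?thesis
    using assms by (simp add: tconj_def pullback_data_def tset_quot tmap_conj_map image_conj_subgroup)
qed

lemma pullback_tres_ttr_tnorm:
  assumes "K \<subseteq> carrier G" "L \<subseteq> carrier G"
  shows "tres G (pullback_data R) K L = tres H R (\<phi> ` K) (\<phi> ` L)"
    "ttr G (pullback_data R) K L = ttr H R (\<phi> ` K) (\<phi> ` L)"
    "tnorm G (pullback_data R) K L = tnorm H R (\<phi> ` K) (\<phi> ` L)"
  using assms
  by (simp_all add: tres_def ttr_def tnorm_def pullback_data_def tset_quot tmap_proj)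

end

theorem lemma2p1:
  fixes H :: "('g, 'm) monoid_scheme" and H' :: "('h, 'n) monoid_scheme"
    and \<phi> :: "'g \<Rightarrow> 'h" and R :: "('h, 'r) tambara_data"
  assumes "group H" and "finite (carrier H)"
    and "group H'" and "finite (carrier H')"
    and "\<phi> \<in> iso H H'"
    and "tambara_functor H' R"
  shows "\<exists>S :: ('g, 'r) tambara_data.
    tambara_functor H S \<and>
    (\<forall>K. subgroup K H \<longrightarrow> level S (quot H K) = level R (quot H' (\<phi> ` K))) \<and>
    (\<forall>h K. h \<in> carrier H \<longrightarrow> subgroup K H \<longrightarrow>
      (\<forall>a \<in> carrier (level S (quot H K)). tconj H S h K a = tconj H' R (\<phi> h) (\<phi> ` K) a)) \<and>
    (\<forall>K L. subgroup K H \<longrightarrow> subgroup L H \<longrightarrow> K \<subseteq> L \<longrightarrow>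
      (\<forall>a \<in> carrier (level S (quot H L)). tres H S K L a = tres H' R (\<phi> ` K) (\<phi> ` L) a) \<and>
      (\<forall>a \<in> carrier (level S (quot H K)). ttr H S K L a = ttr H' R (\<phi> ` K) (\<phi> ` L) a) \<and>
      (\<forall>a \<in> carrier (level S (quot H K)). tnorm H S K L a = tnorm H' R (\<phi> ` K) (\<phi> ` L) a))"
proof -
  \<comment> \<open>The groups \<open>G\<close> and \<open>H\<close> of the locale are here
    \<open>H\<close> and \<open>H'\<close>.\<close>
  interpret group_isomorphism H H' \<phi>
    using assms by (simp add: group_isomorphism_def group_isomorphism_axioms_def group_hom_def
        group_hom_axioms_def iso_def)
  show ?thesis
    \<comment> \<open>The witness is \<open>pullback_data R\<close>. Its structure maps on orbits
      equal those of \<open>R\<close> as functions, hence in particular on the carriers.\<close>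
    using pullback_tambara_functor[OF assms(6)]
    by (intro exI[of _ "pullback_data R"])
      (simp add: pullback_level pullback_tconj pullback_tres_ttr_tnorm subgroup.subset)
qed

end
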